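(* Let $n, r\in \mathbb{N}$ with $r>1$ and $n/2>r$. Then $$\mathrm{h}(n,r)\geq \binom{n-\lfloor\frac{n}{r} \rfloor}{r-1}\cdot \left\lfloor\frac{n}{r} \right\rfloor .$$
   Context: For a finite set $A$ of irrational real numbers and an integer $r>1$, let $\mathcal{H}(A,r)$ denote the set of $r$-element subsets $A'\subseteq A$ for which $\sum_{x\in A'} x\in \mathbb{Q}$. Define $\mathrm{h}(n,r):=\max_{A} |\mathcal{H}(A,r)|$, the maximum being over all sets $A$ of $n$ (distinct) irrational real numbers. *)

theory Defs
  imports "HOL-Analysis.Analysis"
begin

definition rational_subsets :: "real set \<Rightarrow> nat \<Rightarrow> real set set" where
  "rational_subsets A r = {A'. A' \<subseteq> A \<and> card A' = r \<and> (\<Sum>x\<in>A'. x) \<in> \<rat>}"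

definition h :: "nat \<Rightarrow> nat \<Rightarrow> nat" where
  "h n r = Max {card (rational_subsets A r) | A. finite A \<and> card A = n \<and> A \<inter> \<rat> = {}}"

(* Max is only meaningful on finite nonempty sets; the following two facts justify its use in h. *)

lemma finite_h_set:
  "finite {card (rational_subsets A r) | A. finite A \<and> card A = n \<and> A \<inter> \<rat> = {}}"
proof (rule finite_subset)
  show "{card (rational_subsets A r) | A. finite A \<and> card A = n \<and> A \<inter> \<rat> = {}} \<subseteq> {..2 ^ n}"
  proof clarsimp
    fix A :: "real set"
    assume fin: "finite A"
    have "rational_subsets A r \<subseteq> Pow A"
      by (auto simp: rational_subsets_def)
    then show "card (rational_subsets A r) \<le> 2 ^ card A"
      using card_mono[of "Pow A"] fin by (simp add: card_Pow)
  qed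
qed simp

lemma h_set_nonempty:
  "{card (rational_subsets A r) | A. finite A \<and> card A = n \<and> A \<inter> \<rat> = {}} \<noteq> {}"
proof -
  have "uncountable (- \<rat> :: real set)"
    using uncountable_UNIV_real countable_rat
    by (metis Compl_partition countable_Un)
  then have "infinite (- \<rat> :: real set)"
    using countable_finite by blast
  then obtain A :: "real set" where "finite A" "card A = n" "A \<subseteq> - \<rat>"
    using infinite_arbitrarily_large by blast
  then show ?thesis by auto
qed

end

theory Submission
  imports Defs
begin

text \<open>
  Fix an irrational \<open>a\<close>. Any \<open>r - 1\<close> numbers from \<open>a + \<int>\<close> together with one number from
  \<open>- (r - 1) a + \<int>\<close> sum to an integer, because the multiples of \<open>a\<close> cancel. All these numbers are
  irrational since \<open>r > 1\<close>, and the two kinds are disjoint since \<open>r a\<close> is irrational. So a set made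
  of \<open>n - k\<close> numbers of the first kind and \<open>k\<close> of the second has at least
  \<open>((n - k) choose (r - 1)) * k\<close> subsets of size \<open>r\<close> with rational sum. The theorem is the case
  \<open>k = n div r\<close>, which makes this count as large as possible: passing from \<open>k\<close> to \<open>k + 1\<close>
  increases it exactly as long as \<open>r (k + 1) < n + 1\<close>.
\<close>

lemma exists_irrational: "\<exists>a::real. a \<notin> \<rat>"
  using uncountable_UNIV_real countable_rat by (metis UNIV_eq_I)

lemma of_nat_mult_irrational:
  fixes a :: real
  assumes "a \<notin> \<rat>" "m \<noteq> 0"
  shows "of_nat m * a \<notin> \<rat>"
proof
  assume "of_nat m * a \<in> \<rat>"
  then have "of_nat m * a / of_nat m \<in> \<rat>" by (rule Rats_divide) simp
  with assms show False by simp
qed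

lemma card_rational_subsets_le_h:
  assumes "finite A" "card A = n" "A \<inter> \<rat> = {}"
  shows "card (rational_subsets A r) \<le> h n r"
  unfolding h_def by (rule Max_ge[OF finite_h_set]) (use assms in blast)

text \<open>
  The subsets counted here are the \<open>insert c S\<close> with \<open>S \<subseteq> B\<close> and \<open>c \<in> C\<close>; disjointness lets one
  read off \<open>S\<close> and \<open>c\<close> as the intersections with \<open>B\<close> and \<open>C\<close>.
\<close>

lemma card_rational_subsets_Un_ge:
  assumes fin: "finite B" "finite C" and disj: "B \<inter> C = {}"
    and rat: "\<And>S c. S \<subseteq> B \<Longrightarrow> card S = m \<Longrightarrow> c \<in> C \<Longrightarrow> c + (\<Sum>x\<in>S. x) \<in> \<rat>"
  shows "(card B choose m) * card C \<le> card (rational_subsets (B \<union> C) (Suc m))"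
proof -
  define P where "P = {S. S \<subseteq> B \<and> card S = m} \<times> C"
  define f where "f = (\<lambda>(S, c :: real). insert c S)"
  have inj: "inj_on f P"
  proof (rule inj_on_inverseI)
    fix p assume "p \<in> P"
    with disj have "f p \<inter> B = fst p" "f p \<inter> C = {snd p}"
      by (auto simp: P_def f_def)
    then show "(\<lambda>X. (X \<inter> B, the_elem (X \<inter> C))) (f p) = p" by simp
  qed
  have sub: "f ` P \<subseteq> rational_subsets (B \<union> C) (Suc m)"
  proof
    fix X assume "X \<in> f ` P"
    then obtain S c where X: "X = insert c S" and S: "S \<subseteq> B" "card S = m" and c: "c \<in> C"
      by (auto simp: P_def f_def)
    from S fin have "finite S" using finite_subset by blast
    moreover have "c \<notin> S" using S c disj by blast
    ultimately show "X \<in> rational_subsets (B \<union> C) (Suc m)"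
      using X S c rat[OF S c] by (auto simp: rational_subsets_def)
  qed
  have "finite (rational_subsets (B \<union> C) (Suc m))"
    by (rule finite_subset[of _ "Pow (B \<union> C)"]) (use fin in \<open>auto simp: rational_subsets_def\<close>)
  then have "card (f ` P) \<le> card (rational_subsets (B \<union> C) (Suc m))"
    using sub by (rule card_mono)
  moreover have "card (f ` P) = (card B choose m) * card C"
    by (simp add: card_image[OF inj]) (simp add: P_def card_cartesian_product n_subsets[OF fin(1)])
  ultimately show ?thesis by simp
qed

lemma h_ge_choose_mult:
  assumes "r > 1" "k \<le> n"
  shows "((n - k) choose (r - 1)) * k \<le> h n r"
proof -
  obtain a :: real where a: "a \<notin> \<rat>" using exists_irrational by blast
  define b where "b = (\<lambda>i::nat. a + of_nat i)"
  define c where "c = (\<lambda>j::nat. of_nat j - of_nat (r - 1) * a)"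
  define B where "B = b ` {..<n - k}"
  define C where "C = c ` {..<k}"
  have b_irrational: "b i \<notin> \<rat>" for i
    using a Rats_diff[of "b i" "of_nat i"] by (auto simp: b_def)
  have c_irrational: "c j \<notin> \<rat>" for j
    using of_nat_mult_irrational[OF a, of "r - 1"] assms Rats_diff[of "of_nat j" "c j"]
    by (auto simp: c_def)
  have "b i \<noteq> c j" for i j
  proof
    assume "b i = c j"
    then have "of_nat r * a = of_nat j - of_nat i"
      using assms by (simp add: b_def c_def of_nat_diff algebra_simps)
    then have "of_nat r * a \<in> \<rat>" by simp
    with of_nat_mult_irrational[OF a, of r] assms show False by simp
  qed
  then have disj: "B \<inter> C = {}" by (auto simp: B_def C_def)
  have fin: "finite B" "finite C" by (simp_all add: B_def C_def)
  have cards: "card B = n - k" "card C = k"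
    by (simp_all add: B_def C_def b_def c_def card_image inj_on_def)
  have "x + (\<Sum>y\<in>S. y) \<in> \<rat>" if S: "S \<subseteq> B" "card S = r - 1" and x: "x \<in> C" for S x
  proof -
    have "(\<Sum>y\<in>S. y - a) \<in> \<rat>"
      by (rule Rats_sum) (use S in \<open>auto simp: B_def b_def\<close>)
    moreover have "x + of_nat (r - 1) * a \<in> \<rat>"
      using x by (auto simp: C_def c_def)
    ultimately have "(x + of_nat (r - 1) * a) + (\<Sum>y\<in>S. y - a) \<in> \<rat>"
      by (rule Rats_add[rotated])
    then show ?thesis using S by (simp add: sum_subtractf)
  qed
  then have "(card B choose (r - 1)) * card C \<le> card (rational_subsets (B \<union> C) (Suc (r - 1)))"
    by (rule card_rational_subsets_Un_ge[OF fin disj])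
  then have "((n - k) choose (r - 1)) * k \<le> card (rational_subsets (B \<union> C) r)"
    using assms by (simp add: cards)
  also have "\<dots> \<le> h n r"
  proof (rule card_rational_subsets_le_h)
    show "card (B \<union> C) = n" using assms by (simp add: card_Un_disjoint fin disj cards)
    show "(B \<union> C) \<inter> \<rat> = {}" using b_irrational c_irrational by (auto simp: B_def C_def)
  qed (use fin in simp)
  finally show ?thesis .
qed

theorem theorem1p8:
  fixes n r :: nat
  assumes "r > 1"
    and "real n / 2 > real r"
  shows "h n r \<ge> ((n - n div r) choose (r - 1)) * (n div r)"
  using assms(1) by (rule h_ge_choose_mult) (rule div_le_dividend)

end
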